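(* Let $m>n\ge 1$, $A\in\mathbb{R}^{m\times n}$, $b\in\mathbb{R}^m$ satisfy $0<\sigma_{n+1}<\hat\sigma_n$, and let $x$ be the TLS solution. Let $A^TA+\sigma_{n+1}^2 I_n-\frac{2\sigma_{n+1}^2\,xx^T}{\|x\|^2+1}=LL^T$ be the Cholesky factorization. Then $$\kappa_g(A,b)=\sqrt{\|x\|^2+1}\;\left\|(A^TA-\sigma_{n+1}^2I_n)^{-1}L\right\|.$$
   Context: $\|\cdot\|$ is the Euclidean norm for vectors and the spectral norm for matrices; $\|\cdot\|_F$ is the Frobenius norm. $\hat\sigma_1\ge\cdots\ge\hat\sigma_n$ are the singular values of $A$ and $\sigma_1\ge\cdots\ge\sigma_{n+1}$ are the singular values of $[A\ \,b]\in\mathbb{R}^{m\times(n+1)}$. The total least squares (TLS) problem is $\min\|[E\ \,r]\|_F$ subject to $b-r\in\mathcal{R}(A+E)$ ($\mathcal R$ = range); under $\sigma_{n+1}<\hat\sigma_n$ its unique solution is $x=(A^TA-\sigma_{n+1}^2I_n)^{-1}A^Tb$. Absolute condition number: for $(\tilde A,\tilde b)$ in a small neighbourhood of $(A,b)$, let $\tilde\sigma_{n+1}$ be the smallest singular value of $[\tilde A\ \,\tilde b]$ and let $g:\mathbb{R}^{m(n+1)}\to\mathbb{R}^n$ be the map $[\mathrm{vec}(\tilde A)^T,\tilde b^T]^T\mapsto(\tilde A^T\tilde A-\tilde\sigma_{n+1}^2I_n)^{-1}\tilde A^T\tilde b$, i.e. the TLS solution map, where $\mathrm{vec}$ stacks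 columns. Then $\kappa_g(A,b):=\|g'([\mathrm{vec}(A)^T,b^T]^T)\|$, the spectral norm of the derivative of $g$ at $(A,b)$. *)

theory Defs
  imports "HOL-Analysis.Analysis"
begin

text \<open>A matrix with rows indexed by \<open>'m\<close> and columns by \<open>'n\<close> has type \<^typ>\<open>real^'n^'m\<close>. The
  \<^const>\<open>norm\<close> of this type is the Frobenius norm, that of \<^typ>\<open>real^'n\<close> is the Euclidean norm.\<close>

definition spectral_norm :: "real^'n^'m \<Rightarrow> real" where
  "spectral_norm M = onorm (\<lambda>v. M *v v)"

text \<open>Defining singular values by pairs of singular vectors, rather than by the eigenvalues of
  \<open>M\<^sup>T M\<close> alone, gives the usual \<open>min(m,n)\<close> values for every shape of \<open>M\<close>: there is no spurious
  value \<open>0\<close> when \<open>M\<close> has more columns than rows. Multiplicities are not recorded, which does not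
  affect the last entry of the decreasing enumeration of the singular values.\<close>

definition singular_values :: "real^'n^'m \<Rightarrow> real set" where
  "singular_values M = {s. s \<ge> 0 \<and> (\<exists>u v. norm u = 1 \<and> norm v = 1 \<and>
     M *v v = s *\<^sub>R u \<and> transpose M *v u = s *\<^sub>R v)}"

definition smallest_singular_value :: "real^'n^'m \<Rightarrow> real" where
  "smallest_singular_value M = Min (singular_values M)"

text \<open>The matrix \<open>[A b]\<close>; the index \<^const>\<open>None\<close> is that of the appended column.\<close>

definition augment :: "real^'n^'m \<Rightarrow> real^'m \<Rightarrow> real^('n option)^'m" where
  "augment A b = (\<chi> i k. case k of Some j \<Rightarrow> A $ i $ j | None \<Rightarrow> b $ i)"

definition tls_feasible :: "real^'n^'m \<Rightarrow> real^'m \<Rightarrow> real^'n^'m \<Rightarrow> real^'m \<Rightarrow> bool" where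
  "tls_feasible A b E r \<longleftrightarrow> b - r \<in> range (\<lambda>y. (A + E) *v y)"

definition tls_solution :: "real^'n^'m \<Rightarrow> real^'m \<Rightarrow> real^'n \<Rightarrow> bool" where
  "tls_solution A b x \<longleftrightarrow> (\<exists>E r. (A + E) *v x = b - r \<and>
     (\<forall>E' r'. tls_feasible A b E' r' \<longrightarrow> norm (augment E r) \<le> norm (augment E' r')))"

text \<open>The vector \<open>[vec(A)\<^sup>T, b\<^sup>T]\<^sup>T\<close>: the coordinate \<open>Inl (j, i)\<close> is the \<open>i\<close>-th entry of the
  \<open>j\<close>-th column of \<open>A\<close>.\<close>

definition stack :: "real^'n^'m \<Rightarrow> real^'m \<Rightarrow> real^(('n \<times> 'm) + 'm)" where
  "stack A b = (\<chi> k. case k of Inl (j, i) \<Rightarrow> A $ i $ j | Inr i \<Rightarrow> b $ i)"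

definition unstack_mat :: "real^(('n::finite \<times> 'm::finite) + 'm) \<Rightarrow> real^'n^'m" where
  "unstack_mat z = (\<chi> i j. z $ Inl (j, i))"

definition unstack_vec :: "real^(('n::finite \<times> 'm::finite) + 'm) \<Rightarrow> real^'m" where
  "unstack_vec z = (\<chi> i. z $ Inr i)"

definition tls_formula :: "real^'n^'m \<Rightarrow> real^'m \<Rightarrow> real^'n" where
  "tls_formula A b =
     matrix_inv (transpose A ** A - (smallest_singular_value (augment A b))\<^sup>2 *\<^sub>R mat 1)
       *v (transpose A *v b)"

definition tls_map :: "real^(('n::finite \<times> 'm::finite) + 'm) \<Rightarrow> real^'n" where
  "tls_map z = tls_formula (unstack_mat z) (unstack_vec z)"

definition tls_cond :: "real^'n^'m \<Rightarrow> real^'m \<Rightarrow> real" where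
  "tls_cond A b = spectral_norm (matrix (frechet_derivative tls_map (at (stack A b))))"

definition outer :: "real^'n \<Rightarrow> real^'n \<Rightarrow> real^'n^'n" where
  "outer x y = (\<chi> i j. x $ i * y $ j)"

text \<open>Triangularity refers to a linear order on the index type; every finite linearly ordered type
  is order isomorphic to \<open>{1..n}\<close>.\<close>

definition cholesky_factor :: "real^('n::{finite,linorder})^('n::{finite,linorder}) \<Rightarrow> real^('n::{finite,linorder})^('n::{finite,linorder}) \<Rightarrow> bool" where
  "cholesky_factor B L \<longleftrightarrow>
     (\<forall>i j. i < j \<longrightarrow> L $ i $ j = 0) \<and> (\<forall>i. L $ i $ i > 0) \<and> B = L ** transpose L"

end

theory Submission
  imports Defs
begin

text \<open>Put \<open>M = [A b]\<close>. A TLS solution \<open>x\<close> makes \<open>w = (x, -1)\<close> a right singular vector of \<open>M\<close> for its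
  smallest singular value \<open>\<sigma>\<close>. Both \<open>\<sigma>\<close> and the smallest singular value of \<open>A\<close> are 1-Lipschitz, so the
  gap between them persists near \<open>(A, b)\<close> and makes the solution map continuous. Continuity already
  suffices for differentiability: differences of \<open>\<sigma>\<^sup>2\<close> and of \<open>x\<close> are products of a differentiable factor
  vanishing at \<open>(A, b)\<close> and a continuous factor. With \<open>r = b - A x\<close> and \<open>q = f - E x\<close> the derivative in
  direction \<open>(E, f)\<close> is \<open>(A\<^sup>T A - \<sigma>\<^sup>2 I)\<^sup>-\<^sup>1 J(E, f)\<close>, where
  \<open>J(E, f) = E\<^sup>T r + A\<^sup>T q + 2 (r \<bullet> q) x / (|x|\<^sup>2 + 1)\<close>, and \<open>J J\<^sup>T = (|x|\<^sup>2 + 1) L L\<^sup>T\<close> follows from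
  \<open>A\<^sup>T r = - \<sigma>\<^sup>2 x\<close> and \<open>|r|\<^sup>2 = \<sigma>\<^sup>2 (|x|\<^sup>2 + 1)\<close>.\<close>

subsection \<open>Smallest singular values\<close>

lemma inner_transpose_mult: "inner (transpose A *v u) v = inner u ((A::real^'n^'m) *v v)"
  by (simp add: dot_lmul_matrix)

lemma norm_matrix_vector_le: "norm (A *v v) \<le> norm A * norm v" for A :: "real^'n^'m"
proof -
  have "norm (A *v v) \<le> L2_set (\<lambda>i. norm (A $ i) * norm v) UNIV"
    unfolding norm_vec_def[of "A *v v"]
    by (intro L2_set_mono) (auto simp: matrix_vector_mul_component Cauchy_Schwarz_ineq2)
  then show ?thesis
    by (simp add: L2_set_left_distrib norm_vec_def[of A])
qed

lemma bounded_bilinear_matrix_vector: "bounded_bilinear (\<lambda>(A::real^'n^'m) v. A *v v)"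
proof
  show "\<exists>K. \<forall>(A::real^'n^'m) v. norm (A *v v) \<le> norm A * norm v * K"
    by (rule exI[of _ 1]) (simp add: norm_matrix_vector_le)
qed (simp_all add: matrix_vector_mult_add_rdistrib matrix_vector_right_distrib
      scaleR_matrix_vector_assoc[symmetric] matrix_vector_mult_scaleR)

text \<open>An injective transpose forces equal dimensions, so it is also onto. A kernel vector
  \<open>w\<close> of \<open>M\<close> then lies in the range of the transpose and is orthogonal to
  itself. The contrapositive supplies a left singular vector for the singular value 0.\<close>

lemma transpose_injective_imp_injective:
  fixes M :: "real^'k^'m"
  assumes card: "CARD('k) \<le> CARD('m)" and inj: "\<And>u. transpose M *v u = 0 \<Longrightarrow> u = 0"
    and w: "M *v w = 0"
  shows "w = 0"
proof -
  have lin: "linear ((*v) (transpose M))" by simp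
  have i: "inj ((*v) (transpose M))"
    using inj linear_injective_0[OF lin] by auto
  have "dim (range ((*v) (transpose M))) = CARD('m)"
    using dim_image_eq[OF lin, of UNIV] i by (simp add: dim_UNIV)
  moreover have "dim (range ((*v) (transpose M))) \<le> CARD('k)"
    using dim_subset_UNIV[of "range ((*v) (transpose M))"] by simp
  ultimately have "dim (range ((*v) (transpose M))) = DIM(real^'k)"
    using card by simp
  then have "span (range ((*v) (transpose M))) = UNIV"
    by (simp only: dim_eq_full)
  moreover have "span (range ((*v) (transpose M))) = range ((*v) (transpose M))"
    by (metis lin linear_span_image span_UNIV)
  ultimately obtain u where "w = transpose M *v u" by auto
  then have "inner w w = 0"
    by (metis inner_transpose_mult inner_zero_right w)
  then show ?thesis by simp
qed

text \<open>The gradient of the quadratic form \<open>|M v|\<^sup>2 - s\<^sup>2 |v|\<^sup>2\<close> vanishes at its minimum \<open>0\<close>.\<close>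

lemma norm_minimizer_imp_eigenvector:
  fixes M :: "real^'k^'m"
  assumes le: "\<And>v. s * norm v \<le> norm (M *v v)" and s: "0 \<le> s"
    and eq: "norm (M *v w) = s * norm w"
  shows "transpose M *v (M *v w) = s\<^sup>2 *\<^sub>R w"
proof -
  define u where "u = transpose M *v (M *v w) - s\<^sup>2 *\<^sub>R w"
  define Q where "Q v = inner (M *v v) (M *v v) - s\<^sup>2 * inner v v" for v
  have Q0: "0 \<le> Q v" for v
  proof -
    have "(s * norm v)\<^sup>2 \<le> (norm (M *v v))\<^sup>2"
      using le s by (intro power_mono) auto
    then show ?thesis by (simp add: Q_def power_mult_distrib power2_norm_eq_inner)
  qed
  have "(norm (M *v w))\<^sup>2 = (s * norm w)\<^sup>2" using eq by simp
  then have Qw: "Q w = 0" by (simp add: Q_def power_mult_distrib power2_norm_eq_inner)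
  have "inner u u = inner (M *v w) (M *v u) - s\<^sup>2 * inner w u"
    by (subst (1) u_def) (simp add: inner_diff_left inner_transpose_mult del: transpose_matrix_vector)
  moreover have "Q (w + t *\<^sub>R u) = Q w + 2 * t * (inner (M *v w) (M *v u) - s\<^sup>2 * inner w u) + t\<^sup>2 * Q u" for t
    by (simp add: Q_def matrix_vector_right_distrib matrix_vector_mult_scaleR inner_add_left
        inner_add_right inner_commute algebra_simps power2_eq_square)
  ultimately have pos: "0 \<le> 2 * t * inner u u + t\<^sup>2 * Q u" for t
    using Q0[of "w + t *\<^sub>R u"] Qw by simp
  have "inner u u = 0"
  proof (rule ccontr)
    assume "inner u u \<noteq> 0"
    then have a: "inner u u > 0" by simp
    \<comment> \<open>Adding 1 keeps \<open>d\<close> positive even when \<open>Q u = 0\<close>,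
      while still \<open>Q u < 2 * d\<close>. The step \<open>t\<close> is thus short enough for the
      negative linear term to outweigh the quadratic one.\<close>
    define d where "d = Q u + 1"
    define t where "t = - inner u u / d"
    have d: "d > 0" using Q0[of u] by (simp add: d_def)
    then have "2 * t * inner u u + t\<^sup>2 * Q u = (inner u u)\<^sup>2 * (Q u - 2 * d) / d\<^sup>2"
      unfolding t_def by (simp add: field_simps power2_eq_square)
    moreover have "\<dots> < 0"
      using a d Q0[of u] by (intro divide_neg_pos mult_pos_neg) (auto simp: d_def)
    ultimately show False using pos[of t] by simp
  qed
  then show ?thesis by (simp add: u_def)
qed

text \<open>Right singular vectors are eigenvectors of M^T M. Distinct singular values, being
  nonnegative, have distinct squares, so their vectors are orthogonal, and an orthogonal family is
  finite. This makes the \<open>Min\<close> in \<open>smallest_singular_value\<close>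
  meaningful.\<close>

lemma finite_singular_values: "finite (singular_values (M::real^'k^'m))"
proof -
  have "\<forall>s\<in>singular_values M. \<exists>v. norm v = 1 \<and> transpose M *v (M *v v) = s\<^sup>2 *\<^sub>R v"
    by (fastforce simp: singular_values_def power2_eq_square matrix_vector_mult_scaleR
        simp del: transpose_matrix_vector)
  then obtain v where v: "\<And>s. s \<in> singular_values M \<Longrightarrow> norm (v s) = 1"
    and ev: "\<And>s. s \<in> singular_values M \<Longrightarrow> transpose M *v (M *v v s) = s\<^sup>2 *\<^sub>R v s"
    by metis
  have orth: "inner (v s) (v t) = 0" if "s \<in> singular_values M" "t \<in> singular_values M" "s \<noteq> t" for s t
  proof -
    have "s\<^sup>2 * inner (v s) (v t) = inner (M *v v s) (M *v v t)"
      using inner_transpose_mult[of M "M *v v s" "v t"] unfolding ev[OF that(1)] by simp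
    also have "\<dots> = t\<^sup>2 * inner (v s) (v t)"
      using inner_transpose_mult[of M "M *v v t" "v s"] unfolding ev[OF that(2)]
      by (simp add: inner_commute)
    finally have "(s\<^sup>2 - t\<^sup>2) * inner (v s) (v t) = 0" by (simp add: algebra_simps)
    moreover have "s\<^sup>2 \<noteq> t\<^sup>2" using that by (auto simp: singular_values_def)
    ultimately show ?thesis by simp
  qed
  have "pairwise orthogonal (v ` singular_values M)"
    by (auto simp: pairwise_def orthogonal_def intro!: orth)
  then have "finite (v ` singular_values M)" by (rule pairwise_orthogonal_imp_finite)
  moreover have "inj_on v (singular_values M)"
  proof (rule inj_onI, rule ccontr)
    fix s t assume "s \<in> singular_values M" "t \<in> singular_values M" "v s = v t" "s \<noteq> t"
    then have "inner (v s) (v s) = 0" using orth by metis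
    then show False using v \<open>s \<in> _\<close> by force
  qed
  ultimately show ?thesis by (rule finite_imageD)
qed

text \<open>Variational characterization: |M v| attains its minimum on the compact unit sphere, the
  minimizer is a right singular vector, and every singular value is the length of the image of some
  unit vector.\<close>

lemma smallest_singular_value_min:
  fixes M :: "real^'k^'m"
  assumes card: "CARD('k) \<le> CARD('m)"
  shows "\<exists>w. norm w = 1 \<and> norm (M *v w) = smallest_singular_value M"
    and "smallest_singular_value M * norm v \<le> norm (M *v v)"
    and "0 \<le> smallest_singular_value M"
proof -
  have "compact (sphere (0::real^'k) 1)" by simp
  moreover have "sphere (0::real^'k) 1 \<noteq> {}" by simp
  moreover have "continuous_on (sphere 0 1) (\<lambda>v. norm (M *v v))"
    by (intro continuous_intros)
  ultimately obtain w where w: "norm w = 1" and min: "\<And>v. norm v = 1 \<Longrightarrow> norm (M *v w) \<le> norm (M *v v)"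
    using continuous_attains_inf[of "sphere (0::real^'k) 1" "\<lambda>v. norm (M *v v)"] by force
  define s where "s = norm (M *v w)"
  have le: "s * norm v \<le> norm (M *v v)" for v
  proof (cases "v = 0")
    case False
    then have "s \<le> norm (M *v (v /\<^sub>R norm v))" unfolding s_def by (intro min) simp
    then show ?thesis using False by (simp add: matrix_vector_mult_scaleR field_simps)
  qed simp
  have ev: "transpose M *v (M *v w) = s\<^sup>2 *\<^sub>R w"
    by (rule norm_minimizer_imp_eigenvector[OF le]) (simp_all add: s_def w)
  have "s \<in> singular_values M"
  \<comment> \<open>For \<open>s > 0\<close> the left singular vector is \<open>M *v w\<close>
    divided by \<open>s\<close>. For \<open>s = 0\<close> it has to be found separately, as a unit
    vector in the kernel of the transpose, which exists since there are at most as many columns as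
    rows.\<close>
  proof (cases "s = 0")
    case True
    then have Mw: "M *v w = 0" by (simp add: s_def)
    have "w \<noteq> 0" using w by auto
    then obtain u where u: "transpose M *v u = 0" "u \<noteq> 0"
      using transpose_injective_imp_injective[OF card _ Mw] by metis
    define u' where "u' = u /\<^sub>R norm u"
    have "norm u' = 1" "transpose M *v u' = 0"
      using u by (auto simp: u'_def matrix_vector_mult_scaleR simp del: transpose_matrix_vector)
    then show ?thesis
      unfolding singular_values_def using True Mw w by auto
  next
    case False
    then have "s > 0" by (simp add: s_def)
    moreover define u where "u = (M *v w) /\<^sub>R s"
    ultimately have "norm u = 1" "M *v w = s *\<^sub>R u" "transpose M *v u = s *\<^sub>R w"
      using ev by (auto simp: s_def matrix_vector_mult_scaleR power2_eq_square simp del: transpose_matrix_vector)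
    then show ?thesis
      unfolding singular_values_def using w \<open>s > 0\<close> by auto
  qed
  moreover have "s \<le> t" if t: "t \<in> singular_values M" for t
  proof -
    from t obtain u v where "t \<ge> 0" "norm u = 1" "norm v = 1" "M *v v = t *\<^sub>R u"
      by (auto simp: singular_values_def)
    then show ?thesis using le[of v] by simp
  qed
  ultimately have s: "smallest_singular_value M = s"
    unfolding smallest_singular_value_def by (intro Min_eqI finite_singular_values)
  show "\<exists>w. norm w = 1 \<and> norm (M *v w) = smallest_singular_value M"
    using w s s_def by auto
  show "smallest_singular_value M * norm v \<le> norm (M *v v)" using le s by simp
  show "0 \<le> smallest_singular_value M" by (simp add: s s_def)
qed

text \<open>A unit vector that is optimal for one matrix is a competitor for the other, at an extra
  cost of at most the norm of the difference. Exchanging the matrices gives the other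
  inequality.\<close>

lemma smallest_singular_value_lipschitz:
  fixes M N :: "real^'k^'m"
  assumes card: "CARD('k) \<le> CARD('m)"
  shows "\<bar>smallest_singular_value M - smallest_singular_value N\<bar> \<le> norm (M - N)"
proof -
  have *: "smallest_singular_value M \<le> smallest_singular_value N + norm (M - N)" for M N :: "real^'k^'m"
  proof -
    obtain w where w: "norm w = 1" "norm (N *v w) = smallest_singular_value N"
      using smallest_singular_value_min(1)[OF card] by metis
    have "smallest_singular_value M \<le> norm (N *v w + (M - N) *v w)"
      using smallest_singular_value_min(2)[OF card, of M w] w
      by (simp add: matrix_vector_mult_diff_rdistrib)
    also have "\<dots> \<le> smallest_singular_value N + norm (M - N)"
      using norm_triangle_ineq[of "N *v w" "(M - N) *v w"] norm_matrix_vector_le[of "M - N" w] w by simp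
    finally show ?thesis .
  qed
  show ?thesis using *[of M N] *[of N M] by (simp add: norm_minus_commute)
qed

subsection \<open>The TLS equations\<close>

lemma matrix_inv_works:
  assumes "invertible A"
  shows "A ** matrix_inv A = mat 1" and "matrix_inv A ** A = mat 1"
  using someI_ex[OF assms[unfolded invertible_def]] by (auto simp: matrix_inv_def)

section \<open>Block calculus for vectors (x, t), matrices [A b] and rank-one matrices\<close>

definition append_entry :: "real^'n \<Rightarrow> real \<Rightarrow> real^('n option)" where
  "append_entry x t = (\<chi> k. case k of Some j \<Rightarrow> x $ j | None \<Rightarrow> t)"

text \<open>The rectangular matrix u v^T; the type of \<open>outer\<close> covers square matrices
  only.\<close>

definition rank_one :: "real^'m \<Rightarrow> real^'n \<Rightarrow> real^'n^'m" where
  "rank_one u v = (\<chi> i j. u $ i * v $ j)"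

lemma sum_UNIV_option: "(\<Sum>k\<in>UNIV. f k) = (\<Sum>j\<in>UNIV. f (Some j)) + f None"
  for f :: "'n::finite option \<Rightarrow> 'a::comm_monoid_add"
  by (simp add: UNIV_option_conv sum.reindex add.commute)

lemma append_entry_cases:
  obtains x t where "w = append_entry x t"
proof
  show "w = append_entry (\<chi> j. w $ Some j) (w $ None)"
    by (simp add: append_entry_def vec_eq_iff split: option.split)
qed

lemma append_entry_eq_iff [simp]: "append_entry x t = append_entry y s \<longleftrightarrow> x = y \<and> t = s"
  by (auto simp: append_entry_def vec_eq_iff split: option.splits)

lemma scaleR_append_entry [simp]: "c *\<^sub>R append_entry x t = append_entry (c *\<^sub>R x) (c * t)"
  by (auto simp: append_entry_def vec_eq_iff split: option.splits)

lemma norm_append_entry: "norm (append_entry x t) = sqrt ((norm x)\<^sup>2 + t\<^sup>2)"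
  by (simp add: norm_eq_sqrt_inner append_entry_def inner_vec_def sum_UNIV_option power2_eq_square
      sum_nonneg)

lemma augment_mult_append_entry: "augment A b *v append_entry x t = A *v x + t *\<^sub>R b"
  by (simp add: vec_eq_iff augment_def append_entry_def matrix_vector_mult_def sum_UNIV_option
      mult.commute)

lemma transpose_augment_mult:
  "transpose (augment A b) *v u = append_entry (transpose A *v u) (inner b u)"
  by (simp add: vec_eq_iff augment_def append_entry_def matrix_vector_mult_def transpose_def
      inner_vec_def del: transpose_matrix_vector split: option.split)

lemma norm_augment: "(norm (augment E r))\<^sup>2 = (norm E)\<^sup>2 + (norm r)\<^sup>2"
  by (simp add: power2_norm_eq_inner augment_def inner_vec_def sum_UNIV_option sum.distrib)

lemma inner_rank_one: "inner E (rank_one u v) = inner u (E *v v)"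
  by (simp add: rank_one_def inner_vec_def matrix_vector_mult_def sum_distrib_left mult_ac)

lemma rank_one_mult: "rank_one u v *v w = inner v w *\<^sub>R u"
  by (simp add: vec_eq_iff rank_one_def inner_vec_def matrix_vector_mult_def sum_distrib_left
      sum_distrib_right mult_ac)

lemma norm_rank_one: "norm (rank_one u v) = norm u * norm v"
  by (simp add: norm_eq_sqrt_inner inner_rank_one rank_one_mult real_sqrt_mult)

text \<open>The quadratic form of the shifted matrix A^T A - s^2 I is bounded below by (t^2 - s^2)
  |k|^2, and Cauchy-Schwarz turns this into a bound on the image of \<open>k\<close>. It yields both
  invertibility of the shifted matrix and continuity of the solution map.\<close>

lemma normal_matrix_shift_bound:
  fixes A :: "real^'n^'m"
  assumes le: "\<And>v. t * norm v \<le> norm (A *v v)" and t: "0 \<le> t"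
  shows "(t\<^sup>2 - s\<^sup>2) * norm k \<le> norm (transpose A *v (A *v k) - s\<^sup>2 *\<^sub>R k)"
proof (cases "k = 0")
  case False
  have "(t\<^sup>2 - s\<^sup>2) * (norm k)\<^sup>2 = (t * norm k)\<^sup>2 - s\<^sup>2 * (norm k)\<^sup>2"
    by (simp add: algebra_simps power_mult_distrib)
  also have "\<dots> \<le> (norm (A *v k))\<^sup>2 - s\<^sup>2 * (norm k)\<^sup>2"
    using power_mono[OF le[of k]] t by simp
  also have "\<dots> = inner (transpose A *v (A *v k) - s\<^sup>2 *\<^sub>R k) k"
    unfolding inner_diff_left inner_transpose_mult by (simp add: power2_norm_eq_inner)
  also have "\<dots> \<le> norm (transpose A *v (A *v k) - s\<^sup>2 *\<^sub>R k) * norm k"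
    by (rule norm_cauchy_schwarz)
  finally show ?thesis using False by (simp add: power2_eq_square)
qed simp

lemma shifted_normal_matrix_mult:
  "(transpose A ** A - s *\<^sub>R mat 1) *v k = transpose A *v (A *v k) - s *\<^sub>R k" for A :: "real^'n^'m"
  by (simp add: matrix_vector_mult_diff_rdistrib matrix_vector_mul_assoc
      scaleR_matrix_vector_assoc[symmetric] del: transpose_matrix_vector)

section \<open>Consequences of the gap between the smallest singular values of [A b] and A\<close>

locale tls_generic =
  fixes A :: "real^'n^'m" and b :: "real^'m" and s :: real
  assumes card: "CARD('n) < CARD('m)"
    and s: "s = smallest_singular_value (augment A b)"
    and less: "s < smallest_singular_value A"
begin

lemma s_nonneg: "0 \<le> s"
  unfolding s using card by (intro smallest_singular_value_min) (simp add: card_UNIV_option)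

lemma augment_bound: "s * sqrt ((norm y)\<^sup>2 + t\<^sup>2) \<le> norm (A *v y + t *\<^sub>R b)"
  using smallest_singular_value_min(2)[of "augment A b" "append_entry y t"] card
  by (simp add: card_UNIV_option norm_append_entry augment_mult_append_entry s)

lemma shift_bound:
  "((smallest_singular_value A)\<^sup>2 - s\<^sup>2) * norm k \<le> norm (transpose A *v (A *v k) - s\<^sup>2 *\<^sub>R k)"
  by (rule normal_matrix_shift_bound) (use smallest_singular_value_min[of A] card in auto)

lemma gap: "0 < (smallest_singular_value A)\<^sup>2 - s\<^sup>2"
  using less s_nonneg by (simp add: power_strict_mono)

lemma invertible_shift: "invertible (transpose A ** A - s\<^sup>2 *\<^sub>R mat 1)"
proof -
  have "k = 0" if "(transpose A ** A - s\<^sup>2 *\<^sub>R mat 1) *v k = 0" for k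
  proof -
    have "((smallest_singular_value A)\<^sup>2 - s\<^sup>2) * norm k \<le> 0"
      using shift_bound[of k] that unfolding shifted_normal_matrix_mult by simp
    then show ?thesis using gap by (simp add: mult_le_0_iff)
  qed
  then show ?thesis
    unfolding invertible_left_inverse matrix_left_invertible_ker by blast
qed

lemma eq_tls_formula:
  assumes "transpose A *v (A *v y) - s\<^sup>2 *\<^sub>R y = transpose A *v b"
  shows "y = tls_formula A b"
proof -
  have "tls_formula A b = matrix_inv (transpose A ** A - s\<^sup>2 *\<^sub>R mat 1) *v
      ((transpose A ** A - s\<^sup>2 *\<^sub>R mat 1) *v y)"
    unfolding tls_formula_def s[symmetric] shifted_normal_matrix_mult assms ..
  then show ?thesis
    unfolding matrix_vector_mul_assoc matrix_inv_works(2)[OF invertible_shift] by simp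
qed

text \<open>The hypothesis says that (y, -1) attains the minimal ratio \<open>s\<close> of |[A b] v|
  to |v|, so it is an eigenvector of [A b]^T [A b] for \<open>s\<^sup>2\<close>. The two block rows
  of the eigenvector equation are the two conclusions.\<close>

lemma minimizer_equations:
  assumes "norm (A *v y - b) = s * sqrt ((norm y)\<^sup>2 + 1)"
  shows "transpose A *v (A *v y) - s\<^sup>2 *\<^sub>R y = transpose A *v b"
    and "inner b (b - A *v y) = s\<^sup>2"
proof -
  have "transpose (augment A b) *v (augment A b *v append_entry y (-1)) = s\<^sup>2 *\<^sub>R append_entry y (-1)"
  proof (rule norm_minimizer_imp_eigenvector)
    show "s * norm v \<le> norm (augment A b *v v)" for v
      unfolding s using card by (intro smallest_singular_value_min) (simp add: card_UNIV_option)
  qed (use assms s_nonneg in \<open>simp_all add: augment_mult_append_entry norm_append_entry\<close>)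
  then have "transpose A *v (A *v y - b) = s\<^sup>2 *\<^sub>R y" "inner b (A *v y - b) = - s\<^sup>2"
    unfolding augment_mult_append_entry transpose_augment_mult by simp_all
  then show "transpose A *v (A *v y) - s\<^sup>2 *\<^sub>R y = transpose A *v b" "inner b (b - A *v y) = s\<^sup>2"
    by (simp_all add: matrix_vector_mult_diff_distrib inner_diff_right algebra_simps
        del: transpose_matrix_vector)
qed

text \<open>By the gap between \<open>s\<close> and the smallest singular value of \<open>A\<close>, the last entry of a minimizing
  vector cannot vanish, so that it can be scaled to \<open>-1\<close>.\<close>

lemma norm_tls_residual:
  "norm (A *v tls_formula A b - b) = s * sqrt ((norm (tls_formula A b))\<^sup>2 + 1)"
proof -
  have "CARD('n option) \<le> CARD('m)" using card by (simp add: card_UNIV_option)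
  then obtain w where w: "norm w = 1" "norm (augment A b *v w) = s"
    using smallest_singular_value_min(1)[of "augment A b"] s by auto
  obtain v t where v: "w = append_entry v t" by (rule append_entry_cases)
  have "t \<noteq> 0"
  proof
    assume "t = 0"
    then have "norm v = 1" "norm (A *v v) = s"
      using w by (simp_all add: v norm_append_entry augment_mult_append_entry)
    then show False using smallest_singular_value_min(2)[of A v] less card by simp
  qed
  define y where "y = (- 1 / t) *\<^sub>R v"
  have w': "w = (- t) *\<^sub>R append_entry y (-1)"
    using \<open>t \<noteq> 0\<close> by (simp add: v y_def)
  have "norm (augment A b *v w) = s * norm w" using w by simp
  then have "norm (A *v y - b) = s * sqrt ((norm y)\<^sup>2 + 1)"
    using \<open>t \<noteq> 0\<close> unfolding w' matrix_vector_mult_scaleR norm_scaleR augment_mult_append_entry norm_append_entry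
    by simp
  moreover from minimizer_equations(1)[OF this] have "y = tls_formula A b" by (rule eq_tls_formula)
  ultimately show ?thesis by simp
qed

lemmas tls_formula_equations = minimizer_equations[OF norm_tls_residual]

text \<open>The optimal value is at most \<open>s\<close>, by the rank-one correction \<open>[E' r'] = (q / c) [y\<^sup>T 1]\<close>, where
  \<open>y\<close> is the value of the formula, \<open>q = b - A y\<close> and \<open>c = |y|\<^sup>2 + 1\<close>. Hence every solution is a
  minimizer.\<close>

lemma tls_solution_imp_tls_formula:
  assumes "tls_solution A b x"
  shows "x = tls_formula A b"
proof -
  obtain E r where Er: "(A + E) *v x = b - r"
    and min: "\<And>E' r'. tls_feasible A b E' r' \<Longrightarrow> norm (augment E r) \<le> norm (augment E' r')"
    using assms unfolding tls_solution_def by blast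
  define y where "y = tls_formula A b"
  define q where "q = b - A *v y"
  define c where "c = (norm y)\<^sup>2 + 1"
  have c: "c > 0" by (simp add: c_def add_nonneg_pos)
  have q: "norm q = s * sqrt c"
    using norm_tls_residual by (simp add: q_def c_def y_def norm_minus_commute)
  define E' where "E' = rank_one (q /\<^sub>R c) y"
  define r' where "r' = q /\<^sub>R c"
  have "(inner y y / c) *\<^sub>R q + (1 / c) *\<^sub>R q = q"
    unfolding scaleR_add_left[symmetric] using c
    by (simp add: c_def power2_norm_eq_inner add_divide_distrib[symmetric])
  then have "(A + E') *v y = b - r'"
    by (simp add: E'_def r'_def matrix_vector_mult_add_rdistrib rank_one_mult q_def divide_inverse
        algebra_simps)
  then have "tls_feasible A b E' r'"
    unfolding tls_feasible_def by (metis rangeI)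
  then have "norm (augment E r) \<le> norm (augment E' r')" by (rule min)
  moreover have "(norm (augment E' r'))\<^sup>2 = s\<^sup>2"
  proof -
    have "(norm (augment E' r'))\<^sup>2 = (norm q / c)\<^sup>2 * c"
      using c by (simp add: norm_augment E'_def r'_def norm_rank_one c_def power_mult_distrib
          divide_inverse algebra_simps)
    also have "\<dots> = s\<^sup>2 * (c * c) / c\<^sup>2"
      using c by (simp add: q power_divide power_mult_distrib)
    finally show ?thesis using c by (simp add: power2_eq_square)
  qed
  then have "norm (augment E' r') = s" using s_nonneg by simp
  ultimately have le: "norm (augment E r) \<le> s" by simp
  \<comment> \<open>Feasibility expresses the residual at \<open>x\<close> through the correction,
    whose norm is at most \<open>s\<close>. The resulting upper bound is the reverse of
    \<open>augment_bound\<close>, so (x, -1) is a minimizing vector.\<close>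
  have "A *v x - b = - (augment E r *v append_entry x 1)"
    using Er by (simp add: augment_mult_append_entry matrix_vector_mult_add_rdistrib algebra_simps)
  then have "norm (A *v x - b) \<le> norm (augment E r) * sqrt ((norm x)\<^sup>2 + 1)"
    using norm_matrix_vector_le[of "augment E r" "append_entry x 1"]
    by (simp add: norm_append_entry)
  also have "\<dots> \<le> s * sqrt ((norm x)\<^sup>2 + 1)"
    using le by (intro mult_right_mono) auto
  finally have "norm (A *v x - b) = s * sqrt ((norm x)\<^sup>2 + 1)"
    using augment_bound[of x "-1"] by simp
  then show ?thesis by (intro eq_tls_formula minimizer_equations)
qed

end

subsection \<open>The derivative of the TLS solution map\<close>

text \<open>Split off \<open>prod (P z) (Q z0)\<close>, which is differentiable. The rest,
  \<open>prod (P z) (Q z - Q z0)\<close>, is o(|z - z0|), because \<open>P z\<close> is O(|z - z0|)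
  and the other factor tends to 0. No differentiability of \<open>Q\<close> enters.\<close>

lemma (in bounded_bilinear) has_derivative_vanishing_mult_continuous:
  assumes P: "(P has_derivative P') (at z0)" and P0: "P z0 = 0" and Q: "isCont Q z0"
  shows "((\<lambda>z. prod (P z) (Q z)) has_derivative (\<lambda>h. prod (P' h) (Q z0))) (at z0)"
proof -
  have lP: "bounded_linear P'" using P by (rule has_derivative_bounded_linear)
  obtain K where K: "\<And>h. norm (P' h) \<le> norm h * K" using bounded_linear.bounded[OF lP] by blast
  obtain C where C: "\<And>a b. norm (prod a b) \<le> norm a * norm b * C" and "C \<ge> 0"
    using nonneg_bounded by blast
  define e where "e z = norm ((P z - P z0) - P' (z - z0)) / norm (z - z0)" for z
  have e: "(e \<longlongrightarrow> 0) (at z0)"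
    using P unfolding e_def[abs_def] has_derivative_iff_norm by blast
  have bd: "norm (prod (P z) (Q z - Q z0)) / norm (z - z0) \<le> (e z + K) * norm (Q z - Q z0) * C"
    if "z \<noteq> z0" for z
  proof -
    have n: "norm (z - z0) > 0" using that by simp
    have "norm (P z) \<le> norm ((P z - P z0) - P' (z - z0)) + norm (P' (z - z0))"
      using norm_triangle_ineq[of "(P z - P z0) - P' (z - z0)" "P' (z - z0)"] P0 by simp
    also have "\<dots> \<le> (e z + K) * norm (z - z0)"
      using K[of "z - z0"] n by (simp add: e_def field_simps)
    finally have "norm (P z) / norm (z - z0) \<le> e z + K" using n by (simp add: pos_divide_le_eq)
    then have "norm (P z) / norm (z - z0) * (norm (Q z - Q z0) * C) \<le> (e z + K) * (norm (Q z - Q z0) * C)"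
      using \<open>C \<ge> 0\<close> by (intro mult_right_mono) auto
    moreover have "norm (prod (P z) (Q z - Q z0)) / norm (z - z0)
        \<le> norm (P z) * norm (Q z - Q z0) * C / norm (z - z0)"
      using C by (intro divide_right_mono) auto
    ultimately show ?thesis by (simp add: mult_ac)
  qed
  have "((\<lambda>z. (e z + K) * norm (Q z - Q z0) * C) \<longlongrightarrow> (0 + K) * norm (Q z0 - Q z0) * C) (at z0)"
    using Q by (intro tendsto_intros e) (simp add: isCont_def)
  then have lim: "((\<lambda>z. (e z + K) * norm (Q z - Q z0) * C) \<longlongrightarrow> 0) (at z0)" by simp
  have "\<forall>\<^sub>F z in at z0. norm (norm (prod (P z) (Q z - Q z0)) / norm (z - z0)) \<le> (e z + K) * norm (Q z - Q z0) * C"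
    using eventually_neq_at_within[of z0 z0 UNIV]
  proof (rule eventually_mono)
    fix z assume "z \<noteq> z0"
    from bd[OF this] show "norm (norm (prod (P z) (Q z - Q z0)) / norm (z - z0)) \<le> (e z + K) * norm (Q z - Q z0) * C"
      by simp
  qed
  then have "((\<lambda>z. norm (prod (P z) (Q z - Q z0)) / norm (z - z0)) \<longlongrightarrow> 0) (at z0)"
    using lim by (rule Lim_null_comparison)
  then have "((\<lambda>z. prod (P z) (Q z - Q z0)) has_derivative (\<lambda>h. 0)) (at z0)"
    unfolding has_derivative_iff_norm using P0 by (simp add: zero_left)
  moreover have "((\<lambda>z. prod (P z) (Q z0)) has_derivative (\<lambda>h. prod (P' h) (Q z0))) (at z0)"
    by (rule bounded_linear.has_derivative[OF bounded_linear_left P])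
  ultimately have "((\<lambda>z. prod (P z) (Q z0) + prod (P z) (Q z - Q z0)) has_derivative
      (\<lambda>h. prod (P' h) (Q z0) + 0)) (at z0)"
    by (rule has_derivative_add[rotated])
  then show ?thesis by (simp add: diff_right)
qed

lemma continuous_smallest_singular_value:
  assumes card: "CARD('k) \<le> CARD('m)" and f: "isCont f z"
  shows "isCont (\<lambda>z. smallest_singular_value (f z :: real^'k^'m)) z"
proof -
  have "((\<lambda>y. norm (f y - f z)) \<longlongrightarrow> 0) (at z)"
    using f by (simp add: isCont_def LIM_zero_iff tendsto_norm_zero_iff)
  then have "((\<lambda>y. smallest_singular_value (f y) - smallest_singular_value (f z)) \<longlongrightarrow> 0) (at z)"
    by (rule Lim_null_comparison[rotated]) (simp add: smallest_singular_value_lipschitz[OF card])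
  then show ?thesis by (simp add: isCont_def LIM_zero_iff)
qed

lemma bounded_linear_unstack:
  "bounded_linear unstack_mat" "bounded_linear unstack_vec" "bounded_linear (\<lambda>z. transpose (unstack_mat z))"
  by (simp_all add: linear_conv_bounded_linear[symmetric] linear_iff unstack_mat_def unstack_vec_def
      transpose_def vec_eq_iff)

lemma bounded_linear_augment_unstack:
  "bounded_linear (\<lambda>z. augment (unstack_mat z) (unstack_vec z))"
  by (simp add: linear_conv_bounded_linear[symmetric] linear_iff unstack_mat_def unstack_vec_def
      augment_def vec_eq_iff split: option.split)

lemmas continuous_matrix_vector = bounded_bilinear.continuous[OF bounded_bilinear_matrix_vector]
lemmas has_derivative_matrix_vector = bounded_bilinear.FDERIV[OF bounded_bilinear_matrix_vector]
lemmas continuous_unstack = bounded_linear_unstack[THEN bounded_linear.continuous]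
lemmas has_derivative_unstack = bounded_linear_unstack[THEN bounded_linear.has_derivative]

abbreviation tls_sigma :: "real^(('n::finite \<times> 'm::finite) + 'm) \<Rightarrow> real" where
  "tls_sigma z \<equiv> smallest_singular_value (augment (unstack_mat z) (unstack_vec z))"

section \<open>Continuity and differentiability at a base point that has the gap\<close>

locale tls_point =
  fixes z0 :: "real^(('n::finite \<times> 'm::finite) + 'm)"
  assumes card: "CARD('n) < CARD('m)"
    and less: "tls_sigma z0 < smallest_singular_value (unstack_mat z0)"
begin

lemma isCont_singular_values:
  "isCont tls_sigma z0" "isCont (\<lambda>z. smallest_singular_value (unstack_mat z)) z0"
  using card by (simp_all add: continuous_smallest_singular_value linear_continuous_at
      bounded_linear_augment_unstack bounded_linear_unstack card_UNIV_option)

lemma eventually_generic: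
  "\<forall>\<^sub>F z in at z0. tls_generic (unstack_mat z) (unstack_vec z) (tls_sigma z)"
proof -
  have "((\<lambda>z. smallest_singular_value (unstack_mat z) - tls_sigma z) \<longlongrightarrow>
      smallest_singular_value (unstack_mat z0) - tls_sigma z0) (at z0)"
    using isCont_singular_values unfolding isCont_def by (intro tendsto_diff)
  from order_tendstoD(1)[OF this, of 0] less
  show ?thesis using card by (auto simp: tls_generic_def elim!: eventually_mono)
qed

sublocale tls_generic "unstack_mat z0" "unstack_vec z0" "tls_sigma z0"
  using card less by unfold_locales auto

abbreviation "A0 \<equiv> unstack_mat z0"
abbreviation "T0 \<equiv> transpose (unstack_mat z0)"
abbreviation "b0 \<equiv> unstack_vec z0"
abbreviation "x0 \<equiv> tls_map z0"

text \<open>\<open>F z\<close> below is the defect of \<open>x0\<close> in the equation at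
  \<open>z\<close>. It equals the shifted matrix at \<open>z\<close> applied to
  \<open>tls_map z - x0\<close>, so \<open>shift_bound\<close> at \<open>z\<close> controls the
  error by \<open>norm (F z) / d z\<close>, where \<open>d\<close> tends to a nonzero limit.\<close>

lemma isCont_tls_map: "isCont tls_map z0"
proof -
  define d where "d z = (smallest_singular_value (unstack_mat z))\<^sup>2 - (tls_sigma z)\<^sup>2" for z :: "real^(('n \<times> 'm) + 'm)"
  define F where "F z = transpose (unstack_mat z) *v unstack_vec z -
      (transpose (unstack_mat z) *v (unstack_mat z *v x0) - (tls_sigma z)\<^sup>2 *\<^sub>R x0)" for z :: "real^(('n \<times> 'm) + 'm)"
  have "isCont F z0"
    unfolding F_def by (intro continuous_intros continuous_matrix_vector continuous_unstack isCont_singular_values)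
  moreover have "F z0 = 0"
    using tls_formula_equations(1) by (simp add: F_def tls_map_def del: transpose_matrix_vector)
  ultimately have F: "(F \<longlongrightarrow> 0) (at z0)" by (simp add: isCont_def)
  have "isCont d z0" unfolding d_def by (intro continuous_intros isCont_singular_values)
  then have d: "(d \<longlongrightarrow> d z0) (at z0)" by (simp add: isCont_def)
  have d0: "d z0 \<noteq> 0" using gap by (simp add: d_def)
  have "\<forall>\<^sub>F z in at z0. norm (tls_map z - x0) \<le> norm (F z) / d z"
    using eventually_generic
  proof (rule eventually_mono)
    fix z :: "real^(('n \<times> 'm) + 'm)"
    assume "tls_generic (unstack_mat z) (unstack_vec z) (tls_sigma z)"
    then interpret z: tls_generic "unstack_mat z" "unstack_vec z" "tls_sigma z" .
    have "F z = transpose (unstack_mat z) *v (unstack_mat z *v (tls_map z - x0)) - (tls_sigma z)\<^sup>2 *\<^sub>R (tls_map z - x0)"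
      using z.tls_formula_equations(1)
      by (simp add: F_def tls_map_def matrix_vector_mult_diff_distrib algebra_simps del: transpose_matrix_vector)
    then have "d z * norm (tls_map z - x0) \<le> norm (F z)"
      using z.shift_bound[of "tls_map z - x0"] by (simp add: d_def)
    then show "norm (tls_map z - x0) \<le> norm (F z) / d z"
      using z.gap by (simp add: d_def field_simps)
  qed
  moreover have "((\<lambda>z. norm (F z) / d z) \<longlongrightarrow> norm (0 :: real^'n) / d z0) (at z0)"
    by (intro tendsto_intros F d d0)
  then have "((\<lambda>z. norm (F z) / d z) \<longlongrightarrow> 0) (at z0)" by simp
  ultimately have "((\<lambda>z. tls_map z - x0) \<longlongrightarrow> 0) (at z0)"
    by (rule Lim_null_comparison)
  then show ?thesis by (simp add: isCont_def LIM_zero_iff)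
qed

lemma equations_x0:
  "T0 *v (A0 *v x0) - (tls_sigma z0)\<^sup>2 *\<^sub>R x0 = T0 *v b0" "inner b0 (b0 - A0 *v x0) = (tls_sigma z0)\<^sup>2"
  using tls_formula_equations by (simp_all add: tls_map_def)

text \<open>Pairing the perturbed eigenvector equation with the unperturbed eigenvector expresses the
  change of \<open>\<sigma>\<^sup>2\<close> through quantities in which \<open>tls_map\<close> is only required to be continuous.\<close>

lemma tls_sigma_square_difference:
  fixes z :: "real^(('n \<times> 'm) + 'm)"
  assumes "tls_generic (unstack_mat z) (unstack_vec z) (tls_sigma z)"
  defines "g \<equiv> tls_map z"
  shows "((tls_sigma z)\<^sup>2 - (tls_sigma z0)\<^sup>2) * (1 + inner x0 g) =
    inner (transpose (unstack_mat z) *v (unstack_mat z *v x0 - unstack_vec z) - T0 *v (A0 *v x0 - b0)) g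
    + (inner b0 (A0 *v x0 - b0) - inner (unstack_vec z) (unstack_mat z *v x0 - unstack_vec z))"
proof -
  interpret z: tls_generic "unstack_mat z" "unstack_vec z" "tls_sigma z" by fact
  let ?A = "unstack_mat z" and ?b = "unstack_vec z"
  \<comment> \<open>The left side is the inner product of the images of (x, -1) and (g, -1) under
    [A b]; the right side is the eigenvector equation of (g, -1) paired with (x, -1). It is used at
    \<open>z\<close> with \<open>x0\<close>, and at \<open>z0\<close> with the two vectors
    exchanged.\<close>
  have *: "inner (A *v x - b) (A *v g) - inner b (A *v x - b) = s * (1 + inner x g)"
    if "transpose A *v (A *v g) - s *\<^sub>R g = transpose A *v b" "inner b (b - A *v g) = s"
    for A :: "real^'n^'m" and b s x g
  proof -
    have "transpose A *v (A *v g - b) = s *\<^sub>R g"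
      using that(1) by (simp add: matrix_vector_mult_diff_distrib algebra_simps del: transpose_matrix_vector)
    then have "inner (A *v g - b) (A *v x) = s * inner g x"
      by (metis inner_scaleR_left inner_transpose_mult)
    then show ?thesis using that(2) by (simp add: inner_commute algebra_simps)
  qed
  have "inner (?A *v x0 - ?b) (?A *v g) - inner ?b (?A *v x0 - ?b) = (tls_sigma z)\<^sup>2 * (1 + inner x0 g)"
    using z.tls_formula_equations by (intro *) (simp_all add: g_def tls_map_def)
  moreover have "inner (A0 *v g - b0) (A0 *v x0) - inner b0 (A0 *v g - b0) = (tls_sigma z0)\<^sup>2 * (1 + inner g x0)"
    by (intro * equations_x0)
  moreover have "inner (A0 *v g - b0) (A0 *v x0) - inner b0 (A0 *v g - b0) =
      inner (A0 *v x0 - b0) (A0 *v g) - inner b0 (A0 *v x0 - b0)"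
    by (simp add: inner_diff_left inner_diff_right inner_commute)
  ultimately show ?thesis
    unfolding inner_diff_left[of "transpose _ *v _"] inner_transpose_mult by (simp add: inner_commute algebra_simps)
qed

lemma one_plus_inner_x0: "1 + inner x0 x0 > 0"
  by (simp add: add_pos_nonneg)

text \<open>Dividing \<open>tls_sigma_square_difference\<close> by
  \<open>1 + inner x0 (tls_map z)\<close> leaves products with factors that vanish at
  \<open>z0\<close>. The vanishing-factor rule applies twice: to the pairing with
  \<open>tls_map z\<close>, then to the division.\<close>

lemma has_derivative_tls_sigma_square:
  "((\<lambda>z. (tls_sigma z)\<^sup>2) has_derivative
    (\<lambda>h. 2 * inner (b0 - A0 *v x0) (unstack_vec h - unstack_mat h *v x0) / (1 + inner x0 x0))) (at z0)"
proof -
  define P where "P z = transpose (unstack_mat z) *v (unstack_mat z *v x0 - unstack_vec z) - T0 *v (A0 *v x0 - b0)" for z :: "real^(('n \<times> 'm) + 'm)"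
  define p where "p z = inner b0 (A0 *v x0 - b0) - inner (unstack_vec z) (unstack_mat z *v x0 - unstack_vec z)" for z :: "real^(('n \<times> 'm) + 'm)"
  have P: "(P has_derivative (\<lambda>h. T0 *v (unstack_mat h *v x0 - unstack_vec h)
      + transpose (unstack_mat h) *v (A0 *v x0 - b0))) (at z0)"
    unfolding P_def
    by (rule has_derivative_eq_rhs, (rule has_derivative_diff has_derivative_matrix_vector has_derivative_unstack has_derivative_const has_derivative_ident)+)
      (simp add: fun_eq_iff del: transpose_matrix_vector)
  have p: "(p has_derivative (\<lambda>h. - inner b0 (unstack_mat h *v x0 - unstack_vec h)
      - inner (unstack_vec h) (A0 *v x0 - b0))) (at z0)"
    unfolding p_def
    by (rule has_derivative_eq_rhs, (rule has_derivative_diff has_derivative_inner has_derivative_matrix_vector has_derivative_unstack has_derivative_const has_derivative_ident)+)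
      (simp add: fun_eq_iff algebra_simps)
  have P0: "P z0 = 0" and p0: "p z0 = 0" by (simp_all add: P_def p_def)
  have "((\<lambda>z. inner (P z) (tls_map z) + p z) has_derivative
     (\<lambda>h. inner (T0 *v (unstack_mat h *v x0 - unstack_vec h) + transpose (unstack_mat h) *v (A0 *v x0 - b0)) x0 +
      (- inner b0 (unstack_mat h *v x0 - unstack_vec h) - inner (unstack_vec h) (A0 *v x0 - b0)))) (at z0)"
    by (intro has_derivative_add p bounded_bilinear.has_derivative_vanishing_mult_continuous[OF bounded_bilinear_inner]
        P P0 isCont_tls_map)
  moreover have "isCont (\<lambda>z. inverse (1 + inner x0 (tls_map z))) z0"
    using one_plus_inner_x0 by (intro continuous_intros isCont_tls_map) auto
  ultimately have D: "((\<lambda>z. (inner (P z) (tls_map z) + p z) * inverse (1 + inner x0 (tls_map z))) has_derivative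
     (\<lambda>h. (inner (T0 *v (unstack_mat h *v x0 - unstack_vec h) + transpose (unstack_mat h) *v (A0 *v x0 - b0)) x0 +
      (- inner b0 (unstack_mat h *v x0 - unstack_vec h) - inner (unstack_vec h) (A0 *v x0 - b0)))
      * inverse (1 + inner x0 x0))) (at z0)"
    by (intro bounded_bilinear.has_derivative_vanishing_mult_continuous[OF bounded_bilinear_mult])
      (simp_all add: P0 p0)
  have "((\<lambda>z. 1 + inner x0 (tls_map z)) \<longlongrightarrow> 1 + inner x0 x0) (at z0)"
    using isCont_tls_map by (intro tendsto_intros) (simp add: isCont_def)
  \<comment> \<open>Near \<open>z0\<close> the denominator stays positive, so the division is
    legitimate.\<close>
  from order_tendstoD(1)[OF this one_plus_inner_x0]
  have "\<forall>\<^sub>F z in at z0. (inner (P z) (tls_map z) + p z) * inverse (1 + inner x0 (tls_map z))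
      + (tls_sigma z0)\<^sup>2 = (tls_sigma z)\<^sup>2"
    using eventually_generic
  proof eventually_elim
    case (elim z)
    then show ?case
      using tls_sigma_square_difference[OF elim(2), folded P_def p_def] by (simp add: field_simps)
  qed
  from has_derivative_transform_eventually[OF has_derivative_add[OF D has_derivative_const] this]
  have "((\<lambda>z. (tls_sigma z)\<^sup>2) has_derivative
     (\<lambda>h. (inner (T0 *v (unstack_mat h *v x0 - unstack_vec h) + transpose (unstack_mat h) *v (A0 *v x0 - b0)) x0 +
      (- inner b0 (unstack_mat h *v x0 - unstack_vec h) - inner (unstack_vec h) (A0 *v x0 - b0)))
      * inverse (1 + inner x0 x0) + 0)) (at z0)"
    by (simp add: P0 p0)
  then show ?thesis
    unfolding inner_add_left inner_transpose_mult
    by (rule has_derivative_eq_rhs) (simp add: fun_eq_iff divide_inverse inner_commute algebra_simps)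
qed

lemma has_derivative_tls_map:
  "(tls_map has_derivative (\<lambda>h. matrix_inv (T0 ** A0 - (tls_sigma z0)\<^sup>2 *\<^sub>R mat 1) *v
     (transpose (unstack_mat h) *v (b0 - A0 *v x0) + T0 *v (unstack_vec h - unstack_mat h *v x0) +
      (2 * inner (b0 - A0 *v x0) (unstack_vec h - unstack_mat h *v x0) / (1 + inner x0 x0)) *\<^sub>R x0))) (at z0)"
proof -
  let ?B = "T0 ** A0 - (tls_sigma z0)\<^sup>2 *\<^sub>R mat 1"
  \<comment> \<open>\<open>R z\<close> equals \<open>?B *v (tls_map z - x0)\<close> near
    \<open>z0\<close>, with the matrix frozen at \<open>z0\<close>, so no matrix inverse is
    differentiated. Each term containing \<open>tls_map z\<close> has a differentiable factor that
    vanishes at \<open>z0\<close>.\<close>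
  define R where "R z = (transpose (unstack_mat z) *v unstack_vec z - T0 *v b0)
    - (transpose (unstack_mat z) - T0) *v (unstack_mat z *v tls_map z)
    - T0 *v ((unstack_mat z - A0) *v tls_map z)
    + ((tls_sigma z)\<^sup>2 - (tls_sigma z0)\<^sup>2) *\<^sub>R tls_map z" for z :: "real^(('n \<times> 'm) + 'm)"
  have d1: "((\<lambda>z. transpose (unstack_mat z) *v unstack_vec z - T0 *v b0) has_derivative
     (\<lambda>h. T0 *v unstack_vec h + transpose (unstack_mat h) *v b0 - 0)) (at z0)"
    by (rule has_derivative_diff has_derivative_matrix_vector has_derivative_unstack has_derivative_const has_derivative_ident)+
  have d2: "((\<lambda>z. (transpose (unstack_mat z) - T0) *v (unstack_mat z *v tls_map z)) has_derivative
     (\<lambda>h. (transpose (unstack_mat h) - 0) *v (A0 *v x0))) (at z0)"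
    by (rule bounded_bilinear.has_derivative_vanishing_mult_continuous[OF bounded_bilinear_matrix_vector])
      (intro has_derivative_diff has_derivative_unstack has_derivative_const has_derivative_ident diff_self
        continuous_matrix_vector continuous_unstack isCont_tls_map continuous_ident)+
  have d3: "((\<lambda>z. (unstack_mat z - A0) *v tls_map z) has_derivative
     (\<lambda>h. (unstack_mat h - 0) *v x0)) (at z0)"
    by (rule bounded_bilinear.has_derivative_vanishing_mult_continuous[OF bounded_bilinear_matrix_vector])
      (intro has_derivative_diff has_derivative_unstack has_derivative_const has_derivative_ident diff_self
        isCont_tls_map)+
  have d4: "((\<lambda>z. ((tls_sigma z)\<^sup>2 - (tls_sigma z0)\<^sup>2) *\<^sub>R tls_map z) has_derivative
     (\<lambda>h. (2 * inner (b0 - A0 *v x0) (unstack_vec h - unstack_mat h *v x0) / (1 + inner x0 x0) - 0) *\<^sub>R x0)) (at z0)"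
    by (rule bounded_bilinear.has_derivative_vanishing_mult_continuous[OF bounded_bilinear_scaleR])
      (intro has_derivative_diff has_derivative_tls_sigma_square has_derivative_const diff_self
        isCont_tls_map)+
  have "((\<lambda>z. matrix_inv ?B *v R z + x0) has_derivative
     (\<lambda>h. matrix_inv ?B *v (((T0 *v unstack_vec h + transpose (unstack_mat h) *v b0 - 0)
       - (transpose (unstack_mat h) - 0) *v (A0 *v x0)) - T0 *v ((unstack_mat h - 0) *v x0) +
       (2 * inner (b0 - A0 *v x0) (unstack_vec h - unstack_mat h *v x0) / (1 + inner x0 x0) - 0) *\<^sub>R x0) + 0)) (at z0)"
    unfolding R_def
    by (intro has_derivative_add has_derivative_diff d1 d2 d4 has_derivative_const
       bounded_linear.has_derivative[OF matrix_vector_mul_bounded_linear] d3)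
  moreover have "\<forall>\<^sub>F z in at z0. matrix_inv ?B *v R z + x0 = tls_map z"
    using eventually_generic
  proof (rule eventually_mono)
    fix z :: "real^(('n \<times> 'm) + 'm)"
    assume "tls_generic (unstack_mat z) (unstack_vec z) (tls_sigma z)"
    then interpret z: tls_generic "unstack_mat z" "unstack_vec z" "tls_sigma z" .
    have "R z = ?B *v (tls_map z - x0)"
      using z.tls_formula_equations(1)[folded tls_map_def] equations_x0(1)
      unfolding R_def shifted_normal_matrix_mult
      by (simp add: matrix_vector_mult_diff_distrib matrix_vector_mult_diff_rdistrib algebra_simps del: transpose_matrix_vector)
    then have "matrix_inv ?B *v R z = tls_map z - x0"
      by (simp add: matrix_vector_mul_assoc matrix_inv_works(2)[OF invertible_shift])
    then show "matrix_inv ?B *v R z + x0 = tls_map z" by simp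
  qed
  ultimately have "(tls_map has_derivative
     (\<lambda>h. matrix_inv ?B *v (((T0 *v unstack_vec h + transpose (unstack_mat h) *v b0 - 0)
       - (transpose (unstack_mat h) - 0) *v (A0 *v x0)) - T0 *v ((unstack_mat h - 0) *v x0) +
       (2 * inner (b0 - A0 *v x0) (unstack_vec h - unstack_mat h *v x0) / (1 + inner x0 x0) - 0) *\<^sub>R x0) + 0)) (at z0)"
    by (rule has_derivative_transform_eventually) (simp_all add: R_def)
  then show ?thesis
    by (rule has_derivative_eq_rhs)
      (simp add: fun_eq_iff matrix_vector_mult_diff_distrib algebra_simps del: transpose_matrix_vector)
qed

end

subsection \<open>The spectral norm of the derivative\<close>

text \<open>|M^T u|^2 is the inner product of u with M M^T u, hence at most |u| times the spectral
  norm of M times |M^T u|; one factor |M^T u| cancels.\<close>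

lemma spectral_norm_transpose_le:
  "spectral_norm (transpose M) \<le> spectral_norm M" for M :: "real^'n^'m"
  unfolding spectral_norm_def
proof (rule onorm_bound)
  show pos: "0 \<le> onorm ((*v) M)" by (rule onorm_pos_le) simp
  fix u
  let ?w = "transpose M *v u"
  have "(norm ?w)\<^sup>2 = inner u (M *v ?w)"
    unfolding power2_norm_eq_inner inner_transpose_mult ..
  also have "\<dots> \<le> norm u * norm (M *v ?w)" by (rule norm_cauchy_schwarz)
  also have "\<dots> \<le> norm u * (onorm ((*v) M) * norm ?w)"
    by (intro mult_left_mono onorm) simp_all
  finally have "norm ?w * norm ?w \<le> (onorm ((*v) M) * norm u) * norm ?w"
    by (simp add: power2_eq_square mult_ac del: transpose_matrix_vector)
  then show "norm ?w \<le> onorm ((*v) M) * norm u"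
    using pos by (cases "norm ?w = 0") (simp_all del: transpose_matrix_vector)
qed

lemma spectral_norm_transpose: "spectral_norm (transpose M) = spectral_norm M" for M :: "real^'n^'m"
  using spectral_norm_transpose_le[of M] spectral_norm_transpose_le[of "transpose M"]
  by (simp add: transpose_transpose)

text \<open>\<open>M\<close> and \<open>N\<close> may have different numbers of columns, but their
  transposes act on the same space and can be compared vector by vector.\<close>

lemma spectral_norm_eq_scaled:
  fixes M :: "real^'n^'k" and N :: "real^'m^'k"
  assumes "\<And>y. norm (transpose M *v y) = c * norm (transpose N *v y)" and "0 \<le> c"
  shows "spectral_norm M = c * spectral_norm N"
proof -
  have "spectral_norm (transpose M) = onorm (\<lambda>y. c *\<^sub>R (transpose N *v y))"
    unfolding spectral_norm_def onorm_def by (simp add: assms del: transpose_matrix_vector)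
  also have "\<dots> = c * spectral_norm (transpose N)"
    unfolding spectral_norm_def using \<open>0 \<le> c\<close>
    by (subst onorm_scaleR) (simp_all del: transpose_matrix_vector)
  finally show ?thesis by (simp add: spectral_norm_transpose)
qed

section \<open>Stacked coordinates and the adjoint of the derivative\<close>

lemma unstack_stack [simp]: "unstack_mat (stack A b) = A" "unstack_vec (stack A b) = b"
  by (simp_all add: unstack_mat_def unstack_vec_def stack_def vec_eq_iff)

lemma stack_unstack: "stack (unstack_mat z) (unstack_vec z) = z"
  by (auto simp: unstack_mat_def unstack_vec_def stack_def vec_eq_iff split: sum.split)

lemma inner_stack: "inner (stack A b) (stack E f) = inner A E + inner b f"
proof -
  have "inner (stack A b) (stack E f) = (\<Sum>k\<in>UNIV <+> UNIV. stack A b $ k * stack E f $ k)"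
    by (simp add: inner_vec_def)
  also have "\<dots> = (\<Sum>(j, i)\<in>UNIV \<times> UNIV. A $ i $ j * E $ i $ j) + inner b f"
    by (subst sum.Plus) (simp_all add: stack_def inner_vec_def split_def)
  also have "(\<Sum>(j, i)\<in>UNIV \<times> UNIV. A $ i $ j * E $ i $ j) = inner A E"
    unfolding sum.cartesian_product[symmetric] inner_vec_def by (subst sum.swap) simp
  finally show ?thesis .
qed

lemma norm_stack_rank_one_diff:
  "(norm (stack (rank_one r k - rank_one p x) p))\<^sup>2 =
    ((norm x)\<^sup>2 + 1) * inner p p - 2 * inner r p * inner x k + inner r r * inner k k"
  by (simp add: power2_norm_eq_inner inner_stack inner_diff_left inner_diff_right inner_rank_one
      rank_one_mult inner_commute algebra_simps)

text \<open>The identity \<open>J J\<^sup>T = c L L\<^sup>T\<close> as an equality of quadratic forms: the left-hand side is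
  \<open>|J\<^sup>T k|\<^sup>2\<close>.\<close>

lemma norm_adjoint_derivative:
  fixes A :: "real^'n^'m"
  assumes eq1: "transpose A *v r = - (s *\<^sub>R x)" and eq2: "inner r r = s * c"
    and c: "c = (norm x)\<^sup>2 + 1"
  defines "p \<equiv> \<lambda>k. A *v k + (2 * inner x k / c) *\<^sub>R r"
  shows "(norm (stack (rank_one r k - rank_one (p k) x) (p k)))\<^sup>2 =
    c * (inner (A *v k) (A *v k) + s * inner k k - (2 * s / c) * (inner x k)\<^sup>2)"
proof -
  have "c > 0" using c by (simp add: add_nonneg_pos)
  have rA: "inner r (A *v k) = - (s * inner x k)"
    using inner_transpose_mult[of A r k] unfolding eq1 by simp
  \<comment> \<open>For nonzero \<open>r\<close>, \<open>p k\<close> is the reflection of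
    \<open>A *v k\<close> in the hyperplane orthogonal to \<open>r\<close>. Its component along
    \<open>r\<close> therefore changes sign and its length is that of \<open>A *v k\<close>.\<close>
  have rp: "inner r (p k) = s * inner x k"
    using \<open>c > 0\<close> by (simp add: p_def inner_add_right rA eq2)
  have "inner (p k) (p k) = inner (A *v k) (A *v k) + 2 * (2 * inner x k / c) * inner r (A *v k) + (2 * inner x k / c)\<^sup>2 * inner r r"
    by (simp add: p_def inner_add_right inner_add_left inner_commute power2_eq_square)
  also have "\<dots> = inner (A *v k) (A *v k)"
    using \<open>c > 0\<close> unfolding rA eq2 by (simp add: field_simps power2_eq_square)
  finally show ?thesis
    using \<open>c > 0\<close> unfolding norm_stack_rank_one_diff rp eq2 c[symmetric]
    by (simp add: field_simps power2_eq_square)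
qed

theorem theorem4:
  fixes A :: "real^('n::{finite,linorder})^'m" and b :: "real^'m"
    and x :: "real^('n::{finite,linorder})" and L :: "real^('n::{finite,linorder})^('n::{finite,linorder})" and \<sigma> :: real
  assumes "CARD('n) < CARD('m)"
    and "\<sigma> = smallest_singular_value (augment A b)"
    and "0 < \<sigma>" and "\<sigma> < smallest_singular_value A"
    and "tls_solution A b x"
    and "cholesky_factor
           (transpose A ** A + \<sigma>\<^sup>2 *\<^sub>R mat 1 - (2 * \<sigma>\<^sup>2 / ((norm x)\<^sup>2 + 1)) *\<^sub>R outer x x) L"
  shows "tls_map differentiable (at (stack A b)) \<and>
         tls_cond A b =
           sqrt ((norm x)\<^sup>2 + 1) *
             spectral_norm (matrix_inv (transpose A ** A - \<sigma>\<^sup>2 *\<^sub>R mat 1) ** L)"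
proof -
  interpret G: tls_generic A b \<sigma> using assms by unfold_locales
  interpret P: tls_point "stack A b" using assms by unfold_locales simp_all
  have x: "x = tls_formula A b" using assms(5) by (rule G.tls_solution_imp_tls_formula)
  have x0: "tls_map (stack A b) = x" by (simp add: tls_map_def x)
  define B where "B = transpose A ** A - \<sigma>\<^sup>2 *\<^sub>R mat 1"
  define r where "r = b - A *v x"
  define c where "c = (norm x)\<^sup>2 + 1"
  define D where "D h = matrix_inv B *v
     (transpose (unstack_mat h) *v r + transpose A *v (unstack_vec h - unstack_mat h *v x) +
      (2 * inner r (unstack_vec h - unstack_mat h *v x) / c) *\<^sub>R x)" for h
  have D: "(tls_map has_derivative D) (at (stack A b))"
    using P.has_derivative_tls_map
    unfolding x0 unstack_stack D_def B_def r_def c_def assms(2) power2_norm_eq_inner add.commute[of "1::real"] .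
  have c: "c > 0" by (simp add: c_def add_nonneg_pos)
  have "transpose A *v (A *v x) - \<sigma>\<^sup>2 *\<^sub>R x = transpose A *v b"
    using G.tls_formula_equations(1) by (simp only: x)
  then have eq1: "transpose A *v r = - (\<sigma>\<^sup>2 *\<^sub>R x)"
    by (simp add: r_def matrix_vector_mult_diff_distrib algebra_simps del: transpose_matrix_vector)
  have "(norm r)\<^sup>2 = \<sigma>\<^sup>2 * c"
    using G.norm_tls_residual c
    by (simp add: r_def c_def x norm_minus_commute power_mult_distrib)
  then have eq2: "inner r r = \<sigma>\<^sup>2 * c" by (simp add: power2_norm_eq_inner)
  \<comment> \<open>The adjoint is read off by pairing with an arbitrary direction (E, f). Pairing
    E^T r with \<open>k\<close> gives the block r k^T; the other terms combine to the inner product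
    of \<open>p\<close> with f - E x, which gives the blocks - p x^T and \<open>p\<close>.\<close>
  have adj: "transpose (matrix D) *v y = stack (rank_one r k - rank_one p x) p"
    if k: "k = transpose (matrix_inv B) *v y" and p: "p = A *v k + (2 * inner x k / c) *\<^sub>R r" for y k p
  proof -
    have "inner (transpose (matrix D) *v y) h = inner (stack (rank_one r k - rank_one p x) p) h" for h
    proof -
      define E f q where "E = unstack_mat h" and "f = unstack_vec h" and "q = f - E *v x"
      have h: "h = stack E f" by (simp add: E_def f_def stack_unstack)
      have "inner (transpose (matrix D) *v y) h = inner y (D h)"
        unfolding inner_transpose_mult matrix_vector_mul(3)[OF has_derivative_bounded_linear[OF D], THEN fun_cong] ..
      also have "\<dots> = inner k (transpose E *v r + transpose A *v q + (2 * inner r q / c) *\<^sub>R x)"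
        unfolding D_def k inner_transpose_mult E_def f_def q_def ..
      also have "\<dots> = inner r (E *v k) + inner q (A *v k) + (2 * inner r q / c) * inner x k"
        unfolding inner_add_right inner_commute[of k] inner_transpose_mult by simp
      also have "\<dots> = inner r (E *v k) + inner p q"
        by (simp add: p inner_add_left inner_add_right inner_commute mult_ac)
      also have "\<dots> = inner (stack (rank_one r k - rank_one p x) p) h"
        by (simp add: h inner_stack inner_diff_left inner_diff_right q_def inner_rank_one
            inner_commute[of _ E])
      finally show ?thesis .
    qed
    then show ?thesis using vector_eq_rdot by blast
  qed
  have chol: "L ** transpose L = transpose A ** A + \<sigma>\<^sup>2 *\<^sub>R mat 1 - (2 * \<sigma>\<^sup>2 / c) *\<^sub>R rank_one x x"
    using assms(6) by (simp add: cholesky_factor_def c_def outer_def rank_one_def)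
  have norm_L: "(norm (transpose L *v k))\<^sup>2 =
      inner (A *v k) (A *v k) + \<sigma>\<^sup>2 * inner k k - (2 * \<sigma>\<^sup>2 / c) * (inner x k)\<^sup>2" for k
  proof -
    have "(norm (transpose L *v k))\<^sup>2 = inner k ((L ** transpose L) *v k)"
      unfolding power2_norm_eq_inner inner_transpose_mult matrix_vector_mul_assoc ..
    also have "\<dots> = inner (transpose A *v (A *v k)) k + \<sigma>\<^sup>2 * inner k k - (2 * \<sigma>\<^sup>2 / c) * (inner x k)\<^sup>2"
      unfolding chol
      by (simp add: matrix_vector_mult_diff_rdistrib matrix_vector_mult_add_rdistrib
          scaleR_matrix_vector_assoc[symmetric] rank_one_mult inner_add_right inner_diff_right
          matrix_vector_mul_assoc[symmetric] inner_commute power2_eq_square del: transpose_matrix_vector)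
    finally show ?thesis unfolding inner_transpose_mult .
  qed
  \<comment> \<open>Both sides depend on \<open>y\<close> only through \<open>k\<close>, the
    transposed inverse of \<open>B\<close> applied to \<open>y\<close>, so the identity of quadratic
    forms in \<open>k\<close> suffices.\<close>
  have "norm (transpose (matrix D) *v y) = sqrt c * norm (transpose (matrix_inv B ** L) *v y)" for y
  proof -
    define k where "k = transpose (matrix_inv B) *v y"
    define p where "p = A *v k + (2 * inner x k / c) *\<^sub>R r"
    have "transpose (matrix_inv B ** L) *v y = transpose L *v k"
      unfolding matrix_transpose_mul k_def matrix_vector_mul_assoc ..
    moreover have "(norm (transpose (matrix D) *v y))\<^sup>2 = c * (norm (transpose L *v k))\<^sup>2"
      unfolding adj[OF k_def p_def] norm_L
      unfolding p_def by (rule norm_adjoint_derivative[OF eq1 eq2 c_def])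
    ultimately show ?thesis
      using c by (metis norm_ge_zero real_sqrt_abs abs_of_nonneg real_sqrt_mult)
  qed
  then have "spectral_norm (matrix D) = sqrt c * spectral_norm (matrix_inv B ** L)"
    by (rule spectral_norm_eq_scaled) (use c in simp)
  moreover have "frechet_derivative tls_map (at (stack A b)) = D"
    using frechet_derivative_at[OF D] by simp
  ultimately show ?thesis
    using D unfolding tls_cond_def c_def B_def differentiable_def by auto
qed

end
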